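(* Let $(X,\mathcal A,m)$ and $(\Omega,\mathcal F,\mathbb P)$ be probability spaces, let $\sigma:\Omega\to\Omega$ be a $\mathbb P$-preserving transformation, and let $(P,\sigma)$ be an asymptotically periodic Markov operator cocycle over $\sigma$ acting on $L^1(X,m)$. Then the following are equivalent: (1) $(P,\sigma)$ is exact; (2) $(P,\sigma)$ is prior mixing for inhomogeneous observables in $B(\Omega,L^\infty(X,m))$; (3) $(P,\sigma)$ is posterior mixing for inhomogeneous observables in $B(\Omega,L^\infty(X,m))$; (4) $(P,\sigma)$ is asymptotically stable.
   Context: A Markov operator on $L^1(X,m)$ is a linear positive operator preserving the integral $\int_X\cdot\,dm$. A Markov operator cocycle $(P,\sigma)$ is given by a measurable map $P:\Omega\times L^1(X,m)\to L^1(X,m)$ such that $P_\omega=P(\omega,\cdot)$ is a Markov operator for $\mathbb P$-almost every $\omega$; set $P^{(n)}_\omega=P_{\sigma^{n-1}\omega}\circ\cdots\circ P_{\sigma\omega}\circ P_\omega$. $D(X,m)=\{f\in L^1(X,m):f\ge 0\ m\text{-a.e.},\ \|f\|_{L^1(X)}=1\}$, $L^1_0(X,m)=\{f\in L^1(X,m):\int_X f\,dm=0\}$. $B(\Omega,E)$ denotes the set of all bounded measurable maps from $\Omega$ to $E$; $(L^1(X,m))'$ is the dual space. Asymptotic periodicity: there exist an integer $r\geq 1$, $\{\lambda_i\}_{i=1}^r\subset B(\Omega,(L^1(X,m))')$ and $\{\varphi_i\}_{i=1}^r\subset B(\Omega,D(X,m))$ (written $\lambda_i^\omega=\lambda_i(\omega)$,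 $\varphi_i^\omega=\varphi_i(\omega)$) such that for $\mathbb P$-almost every $\omega$ the densities $\varphi_1^\omega,\dots,\varphi_r^\omega$ have mutually disjoint supports, and there exists a permutation $\rho_\omega$ of $\{1,\dots,r\}$ such that $$P_\omega\varphi_i^\omega=\varphi^{\sigma\omega}_{\rho_\omega(i)}\quad\text{and}\quad\lim_{n\to\infty}\Bigl\|P^{(n)}_\omega\Bigl(f-\sum_{i=1}^r\lambda_i^\omega(f)\varphi_i^\omega\Bigr)\Bigr\|_{L^1(X)}=0$$ for every $f\in L^1(X,m)$, $1\le i\le r$ and $\mathbb P$-almost every $\omega$. If in addition $r=1$, $(P,\sigma)$ is called asymptotically stable. Exact: for $\mathbb P$-almost every $\omega$ and every $f\in L^1_0(X,m)$, $\lim_{n\to\infty}\|P^{(n)}_\omega f\|_{L^1(X)}=0$. Consider (I) $\lim_{n\to\infty}\int_X P^{(n)}_\omega f\cdot g_{\sigma^n\omega}\,dm=0$. Prior mixing for inhomogeneous observables in $B(\Omega,L^\infty(X,m))$: for $\mathbb P$-almost every $\omega$, (I) holds for all $f\in L^1_0(X,m)$ and $g\in B(\Omega,L^\infty(X,m))$. Posterior mixing for inhomogeneous observables in $B(\Omega,L^\infty(X,m))$: for all $f\in L^1_0(X,m)$ and $g\in B(\Omega,L^\infty(X,m))$, (I) holds for $\mathbb P$-almost every $\omega$. *)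

theory Defs
  imports "HOL-Probability.Probability" "HOL-Combinatorics.Permutations"
begin

text \<open>
  Elements of \<open>L\<^sup>1\<close>, \<open>L\<^sup>\<infinity>\<close> and the dual of \<open>L\<^sup>1\<close> are handled through representatives: real
  functions on the underlying type, identified when their difference has seminorm \<open>0\<close>.
  Subtraction on such functions is the pointwise subtraction of \<open>Main\<close>.
\<close>

subsection \<open>Bounded measurable maps into a seminormed space\<close>

text \<open>
  The Borel sigma-algebra of the (relative) topology that the seminorm \<open>N\<close> induces on the set
  \<open>E\<close>. Open sets are unions of classes of elements at distance \<open>0\<close>, so this is the Borel
  sigma-algebra of the quotient, pulled back to representatives. In particular a map that is
  measurable into and out of such spaces automatically respects the identification.
\<close>
definition seminorm_borel :: "'e::minus set \<Rightarrow> ('e \<Rightarrow> real) \<Rightarrow> 'e measure" where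
  "seminorm_borel E N =
     sigma E {U. U \<subseteq> E \<and> (\<forall>u\<in>U. \<exists>\<epsilon>>0. \<forall>v\<in>E. N (v - u) < \<epsilon> \<longrightarrow> v \<in> U)}"

definition separable_subset :: "'e::minus set \<Rightarrow> ('e \<Rightarrow> real) \<Rightarrow> 'e set \<Rightarrow> bool" where
  "separable_subset E N S \<longleftrightarrow>
     (\<exists>Q. countable Q \<and> Q \<subseteq> E \<and> (\<forall>u\<in>S. \<forall>\<epsilon>>0. \<exists>q\<in>Q. N (u - q) < \<epsilon>))"

text \<open>
  The set \<open>B(\<Omega>, E)\<close>. Measurability of maps with values in a Banach space is understood as
  strong (Bochner) measurability, in Pettis's form: Borel measurable with separable range. For
  separable \<open>E\<close> this is plain Borel measurability (lemma below).
\<close>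
definition bounded_measurable ::
    "'w measure \<Rightarrow> 'e::minus set \<Rightarrow> ('e \<Rightarrow> real) \<Rightarrow> ('w \<Rightarrow> 'e) set" where
  "bounded_measurable W E N =
     {F. F \<in> measurable W (seminorm_borel E N) \<and>
         separable_subset E N (F ` space W) \<and>
         (\<exists>C. \<forall>\<omega>\<in>space W. N (F \<omega>) \<le> C)}"

lemma bounded_measurable_separable:
  assumes "separable_subset E N E"
  shows "bounded_measurable W E N =
           {F. F \<in> measurable W (seminorm_borel E N) \<and> (\<exists>C. \<forall>\<omega>\<in>space W. N (F \<omega>) \<le> C)}"
proof -
  have sp: "space (seminorm_borel E N) = E"
    unfolding seminorm_borel_def by (rule space_measure_of) auto
  have "separable_subset E N (F ` space W)" if "F \<in> measurable W (seminorm_borel E N)" for F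
  proof -
    have "F ` space W \<subseteq> E"
      using measurable_space[OF that] sp by auto
    then show ?thesis
      using assms unfolding separable_subset_def by (meson subsetD)
  qed
  then show ?thesis unfolding bounded_measurable_def by blast
qed


subsection \<open>Function spaces\<close>

definition L1 :: "'a measure \<Rightarrow> ('a \<Rightarrow> real) set" where
  "L1 m = {f. integrable m f}"

definition L1_norm :: "'a measure \<Rightarrow> ('a \<Rightarrow> real) \<Rightarrow> real" where
  "L1_norm m f = (\<integral>x. \<bar>f x\<bar> \<partial>m)"

definition L1_zero :: "'a measure \<Rightarrow> ('a \<Rightarrow> real) set" where
  "L1_zero m = {f \<in> L1 m. (\<integral>x. f x \<partial>m) = 0}"

definition densities :: "'a measure \<Rightarrow> ('a \<Rightarrow> real) set" where
  "densities m = {f \<in> L1 m. (AE x in m. 0 \<le> f x) \<and> L1_norm m f = 1}"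

definition Linf :: "'a measure \<Rightarrow> ('a \<Rightarrow> real) set" where
  "Linf m = {g \<in> borel_measurable m. \<exists>C. AE x in m. \<bar>g x\<bar> \<le> C}"

definition Linf_norm :: "'a measure \<Rightarrow> ('a \<Rightarrow> real) \<Rightarrow> real" where
  "Linf_norm m g = real_of_ereal (esssup m (\<lambda>x. ereal \<bar>g x\<bar>))"

text \<open>Bounded linear functionals on \<open>L\<^sup>1\<close>; only their values on \<open>L1 m\<close> matter.\<close>
definition L1_dual :: "'a measure \<Rightarrow> (('a \<Rightarrow> real) \<Rightarrow> real) set" where
  "L1_dual m =
     {l. (\<forall>f\<in>L1 m. \<forall>g\<in>L1 m. \<forall>a b. l (\<lambda>x. a * f x + b * g x) = a * l f + b * l g) \<and>
         (\<exists>C. \<forall>f\<in>L1 m. \<bar>l f\<bar> \<le> C * L1_norm m f)}"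

definition L1_dual_norm :: "'a measure \<Rightarrow> (('a \<Rightarrow> real) \<Rightarrow> real) \<Rightarrow> real" where
  "L1_dual_norm m l = (SUP f\<in>{f \<in> L1 m. L1_norm m f \<le> 1}. \<bar>l f\<bar>)"

definition support :: "'a measure \<Rightarrow> ('a \<Rightarrow> real) \<Rightarrow> 'a set" where
  "support m f = {x \<in> space m. f x \<noteq> 0}"


subsection \<open>Markov operator cocycles\<close>

definition measure_preserving_map :: "'w measure \<Rightarrow> ('w \<Rightarrow> 'w) \<Rightarrow> bool" where
  "measure_preserving_map W \<sigma> \<longleftrightarrow> \<sigma> \<in> measurable W W \<and> distr W W \<sigma> = W"

definition markov_operator ::
    "'a measure \<Rightarrow> (('a \<Rightarrow> real) \<Rightarrow> ('a \<Rightarrow> real)) \<Rightarrow> bool" where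
  "markov_operator m T \<longleftrightarrow>
     (\<forall>f\<in>L1 m. T f \<in> L1 m) \<and>
     (\<forall>f\<in>L1 m. \<forall>g\<in>L1 m. \<forall>a b.
        AE x in m. T (\<lambda>y. a * f y + b * g y) x = a * T f x + b * T g x) \<and>
     (\<forall>f\<in>L1 m. (AE x in m. 0 \<le> f x) \<longrightarrow> (AE x in m. 0 \<le> T f x)) \<and>
     (\<forall>f\<in>L1 m. (\<integral>x. T f x \<partial>m) = (\<integral>x. f x \<partial>m))"

definition markov_cocycle ::
    "'a measure \<Rightarrow> 'w measure \<Rightarrow> ('w \<Rightarrow> ('a \<Rightarrow> real) \<Rightarrow> ('a \<Rightarrow> real)) \<Rightarrow> bool" where
  "markov_cocycle m W P \<longleftrightarrow>
     (\<lambda>(\<omega>, f). P \<omega> f) \<in> measurable (W \<Otimes>\<^sub>M seminorm_borel (L1 m) (L1_norm m))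
                                       (seminorm_borel (L1 m) (L1_norm m)) \<and>
     (AE \<omega> in W. markov_operator m (P \<omega>))"

fun iterate ::
    "('w \<Rightarrow> ('a \<Rightarrow> real) \<Rightarrow> ('a \<Rightarrow> real)) \<Rightarrow> ('w \<Rightarrow> 'w) \<Rightarrow> nat \<Rightarrow> 'w \<Rightarrow>
       ('a \<Rightarrow> real) \<Rightarrow> ('a \<Rightarrow> real)" where
  "iterate P \<sigma> 0 \<omega> = id"
| "iterate P \<sigma> (Suc n) \<omega> = P ((\<sigma> ^^ n) \<omega>) \<circ> iterate P \<sigma> n \<omega>"

definition asymptotically_periodic_with ::
    "nat \<Rightarrow> 'a measure \<Rightarrow> 'w measure \<Rightarrow> ('w \<Rightarrow> 'w) \<Rightarrow>
       ('w \<Rightarrow> ('a \<Rightarrow> real) \<Rightarrow> ('a \<Rightarrow> real)) \<Rightarrow> bool" where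
  "asymptotically_periodic_with r m W \<sigma> P \<longleftrightarrow>
     (\<exists>(lam :: nat \<Rightarrow> 'w \<Rightarrow> ('a \<Rightarrow> real) \<Rightarrow> real) (\<phi> :: nat \<Rightarrow> 'w \<Rightarrow> 'a \<Rightarrow> real).
        (\<forall>i\<in>{1..r}. lam i \<in> bounded_measurable W (L1_dual m) (L1_dual_norm m)) \<and>
        (\<forall>i\<in>{1..r}. \<phi> i \<in> bounded_measurable W (densities m) (L1_norm m)) \<and>
        (AE \<omega> in W.
           (\<forall>i\<in>{1..r}. \<forall>j\<in>{1..r}. i \<noteq> j \<longrightarrow>
              support m (\<phi> i \<omega>) \<inter> support m (\<phi> j \<omega>) \<in> null_sets m) \<and>
           (\<exists>\<rho>. \<rho> permutes {1..r} \<and>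
              (\<forall>i\<in>{1..r}. AE x in m. P \<omega> (\<phi> i \<omega>) x = \<phi> (\<rho> i) (\<sigma> \<omega>) x) \<and>
              (\<forall>f\<in>L1 m.
                 (\<lambda>n. L1_norm m
                    (iterate P \<sigma> n \<omega> (\<lambda>x. f x - (\<Sum>i\<in>{1..r}. lam i \<omega> f * \<phi> i \<omega> x))))
                 \<longlonglongrightarrow> 0))))"

definition asymptotically_periodic ::
    "'a measure \<Rightarrow> 'w measure \<Rightarrow> ('w \<Rightarrow> 'w) \<Rightarrow>
       ('w \<Rightarrow> ('a \<Rightarrow> real) \<Rightarrow> ('a \<Rightarrow> real)) \<Rightarrow> bool" where
  "asymptotically_periodic m W \<sigma> P \<longleftrightarrow> (\<exists>r\<ge>1. asymptotically_periodic_with r m W \<sigma> P)"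

definition asymptotically_stable ::
    "'a measure \<Rightarrow> 'w measure \<Rightarrow> ('w \<Rightarrow> 'w) \<Rightarrow>
       ('w \<Rightarrow> ('a \<Rightarrow> real) \<Rightarrow> ('a \<Rightarrow> real)) \<Rightarrow> bool" where
  "asymptotically_stable m W \<sigma> P \<longleftrightarrow> asymptotically_periodic_with 1 m W \<sigma> P"

definition exact_cocycle ::
    "'a measure \<Rightarrow> 'w measure \<Rightarrow> ('w \<Rightarrow> 'w) \<Rightarrow>
       ('w \<Rightarrow> ('a \<Rightarrow> real) \<Rightarrow> ('a \<Rightarrow> real)) \<Rightarrow> bool" where
  "exact_cocycle m W \<sigma> P \<longleftrightarrow>
     (AE \<omega> in W. \<forall>f\<in>L1_zero m. (\<lambda>n. L1_norm m (iterate P \<sigma> n \<omega> f)) \<longlonglongrightarrow> 0)"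

definition prior_mixing ::
    "'a measure \<Rightarrow> 'w measure \<Rightarrow> ('w \<Rightarrow> 'w) \<Rightarrow>
       ('w \<Rightarrow> ('a \<Rightarrow> real) \<Rightarrow> ('a \<Rightarrow> real)) \<Rightarrow> bool" where
  "prior_mixing m W \<sigma> P \<longleftrightarrow>
     (AE \<omega> in W. \<forall>f\<in>L1_zero m. \<forall>g\<in>bounded_measurable W (Linf m) (Linf_norm m).
        (\<lambda>n. \<integral>x. iterate P \<sigma> n \<omega> f x * g ((\<sigma> ^^ n) \<omega>) x \<partial>m) \<longlonglongrightarrow> 0)"

definition posterior_mixing ::
    "'a measure \<Rightarrow> 'w measure \<Rightarrow> ('w \<Rightarrow> 'w) \<Rightarrow>
       ('w \<Rightarrow> ('a \<Rightarrow> real) \<Rightarrow> ('a \<Rightarrow> real)) \<Rightarrow> bool" where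
  "posterior_mixing m W \<sigma> P \<longleftrightarrow>
     (\<forall>f\<in>L1_zero m. \<forall>g\<in>bounded_measurable W (Linf m) (Linf_norm m).
        AE \<omega> in W. (\<lambda>n. \<integral>x. iterate P \<sigma> n \<omega> f x * g ((\<sigma> ^^ n) \<omega>) x \<partial>m) \<longlonglongrightarrow> 0)"

end

theory Submission
  imports Defs
begin

text \<open>
  The only hard implication is from posterior mixing to \<open>r = 1\<close>. Suppose \<open>r \<ge> 2\<close>. The iterates
  of \<open>\<phi> 1 \<omega> - \<phi> 2 \<omega>\<close> are differences of two distinct, hence disjointly supported, periodic
  densities, so they can be tested against an observable that tells these two densities apart;
  there are only finitely many such pairs. Posterior mixing needs a test function that does not
  depend on \<open>\<omega>\<close>, but the \<open>\<phi> i\<close> have separable range, so countably many differences of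
  densities come close to every \<open>\<phi> 1 \<omega> - \<phi> 2 \<omega>\<close>, and Markov operators preserve closeness.
  Outside a countable union of null sets this contradicts mixing.
\<close>

section \<open>Balls in the seminorm topology, densities, and orbits of a measure-preserving
  map\<close>

lemma space_seminorm_borel [simp]: "space (seminorm_borel E N) = E"
  unfolding seminorm_borel_def by (rule space_measure_of) auto

lemma bounded_measurable_space:
  assumes "F \<in> bounded_measurable W E N" "\<omega> \<in> space W"
  shows "F \<omega> \<in> E"
  using assms measurable_space[of F W "seminorm_borel E N" \<omega>]
  by (auto simp: bounded_measurable_def)

lemma L1_norm_triangle:
  assumes "f \<in> L1 m" "g \<in> L1 m"
  shows "L1_norm m (\<lambda>x. f x + g x) \<le> L1_norm m f + L1_norm m g"
proof -
  have "(\<integral>x. \<bar>f x + g x\<bar> \<partial>m) \<le> (\<integral>x. \<bar>f x\<bar> + \<bar>g x\<bar> \<partial>m)"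
    using assms by (intro integral_mono) (auto simp: L1_def)
  also have "\<dots> = (\<integral>x. \<bar>f x\<bar> \<partial>m) + (\<integral>x. \<bar>g x\<bar> \<partial>m)"
    using assms by (intro Bochner_Integration.integral_add) (auto simp: L1_def)
  finally show ?thesis by (simp add: L1_norm_def)
qed

text \<open>By the triangle inequality balls are open, hence among the generating sets. This is what
  makes the approximation index in \<open>countable_net\<close> measurable.\<close>

lemma L1_ball_in_sets:
  assumes E: "E \<subseteq> L1 m" and q: "q \<in> E"
  shows "{u \<in> E. L1_norm m (u - q) < \<epsilon>} \<in> sets (seminorm_borel E (L1_norm m))"
proof -
  let ?B = "{u \<in> E. L1_norm m (u - q) < \<epsilon>}"
  have "\<exists>\<delta>>0. \<forall>v\<in>E. L1_norm m (v - u) < \<delta> \<longrightarrow> v \<in> ?B" if u: "u \<in> ?B" for u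
  proof (intro exI[of _ "\<epsilon> - L1_norm m (u - q)"] conjI ballI impI)
    fix v assume v: "v \<in> E" "L1_norm m (v - u) < \<epsilon> - L1_norm m (u - q)"
    have "u \<in> L1 m" "v \<in> L1 m" "q \<in> L1 m"
      using u v q E by auto
    then have "L1_norm m (\<lambda>x. (v - u) x + (u - q) x) \<le> L1_norm m (v - u) + L1_norm m (u - q)"
      by (intro L1_norm_triangle) (auto simp: L1_def fun_diff_def)
    moreover have "(\<lambda>x. (v - u) x + (u - q) x) = v - q"
      by (auto simp: fun_eq_iff)
    ultimately show "v \<in> ?B"
      using v by auto
  qed (use u in auto)
  then show ?thesis
    unfolding seminorm_borel_def by (intro in_measure_of) auto
qed

lemma densitiesD:
  assumes "f \<in> densities m"
  shows "integrable m f" "AE x in m. 0 \<le> f x" "(\<integral>x. f x \<partial>m) = 1"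
proof -
  show i: "integrable m f" and nn: "AE x in m. 0 \<le> f x"
    using assms by (auto simp: densities_def L1_def)
  have "(\<integral>x. f x \<partial>m) = (\<integral>x. \<bar>f x\<bar> \<partial>m)"
    by (rule integral_cong_AE) (use i nn in auto)
  then show "(\<integral>x. f x \<partial>m) = 1"
    using assms by (simp add: densities_def L1_norm_def)
qed

text \<open>Preimages of null sets under \<sigma> are null, and only countably many times occur.
  Every almost sure property of the cocycle can thus be used along a whole forward orbit.\<close>

lemma AE_measure_preserving_funpow:
  assumes "measure_preserving_map W \<sigma>" and "AE \<omega> in W. Q \<omega>"
  shows "AE \<omega> in W. \<forall>n. Q ((\<sigma> ^^ n) \<omega>)"
proof -
  have shift: "AE \<omega> in W. R (\<sigma> \<omega>)" if "AE \<omega> in W. R \<omega>" for R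
  proof (rule AE_distrD[of \<sigma> W W])
    show "\<sigma> \<in> measurable W W" and "AE \<omega> in distr W W \<sigma>. R \<omega>"
      using assms(1) that unfolding measure_preserving_map_def by metis+
  qed
  have "AE \<omega> in W. Q ((\<sigma> ^^ n) \<omega>)" for n
  proof (induction n)
    case (Suc n)
    from shift[OF this] show ?case by (simp add: funpow_swap1)
  qed (use assms in simp)
  then show ?thesis by (simp add: AE_all_countable)
qed

lemma funpow_measure_preserving_in_space:
  assumes "measure_preserving_map W \<sigma>" "\<omega> \<in> space W"
  shows "(\<sigma> ^^ n) \<omega> \<in> space W"
  using assms by (induction n) (auto simp: measure_preserving_map_def dest: measurable_space)


subsection \<open>Markov operators\<close>

context
  fixes m :: "'a measure" and T :: "('a \<Rightarrow> real) \<Rightarrow> ('a \<Rightarrow> real)"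
  assumes T: "markov_operator m T"
begin

lemma markov_operator_L1: "f \<in> L1 m \<Longrightarrow> T f \<in> L1 m"
  using T by (simp add: markov_operator_def)

lemma markov_operator_integral: "f \<in> L1 m \<Longrightarrow> (\<integral>x. T f x \<partial>m) = (\<integral>x. f x \<partial>m)"
  using T by (simp add: markov_operator_def)

lemma markov_operator_diff:
  assumes "f \<in> L1 m" "g \<in> L1 m"
  shows "AE x in m. T (\<lambda>y. f y - g y) x = T f x - T g x"
proof -
  have "\<forall>a b. AE x in m. T (\<lambda>y. a * f y + b * g y) x = a * T f x + b * T g x"
    using T assms by (simp add: markov_operator_def)
  from this[rule_format, of 1 "-1"] show ?thesis by simp
qed

lemma markov_operator_mono:
  assumes "f \<in> L1 m" "g \<in> L1 m" "AE x in m. f x \<le> g x"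
  shows "AE x in m. T f x \<le> T g x"
proof -
  have "(\<lambda>y. g y - f y) \<in> L1 m"
    using assms by (auto simp: L1_def)
  moreover have "AE x in m. 0 \<le> g x - f x"
    using assms(3) by auto
  ultimately have "AE x in m. 0 \<le> T (\<lambda>y. g y - f y) x"
    using T by (simp add: markov_operator_def)
  with markov_operator_diff[OF assms(2,1)] show ?thesis
    by eventually_elim simp
qed

text \<open>Operators act on representatives, so compatibility with a.e. equality has to be proved:
  it follows from positivity and linearity, through monotonicity in both directions.\<close>

lemma markov_operator_cong_AE:
  assumes "f \<in> L1 m" "g \<in> L1 m" "AE x in m. f x = g x"
  shows "AE x in m. T f x = T g x"
proof -
  have "AE x in m. T f x \<le> T g x"
    using assms by (intro markov_operator_mono) auto
  moreover have "AE x in m. T g x \<le> T f x"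
    using assms by (intro markov_operator_mono) auto
  ultimately show ?thesis by eventually_elim simp
qed

text \<open>Both \<open>f\<close> and its negative lie below its absolute value; applying
  \<open>T\<close> bounds \<bar>\<open>T f\<close>\<bar> by the image of
  \<bar>\<open>f\<close>\<bar>, whose integral is preserved.\<close>

lemma markov_operator_contraction:
  assumes f: "f \<in> L1 m"
  shows "L1_norm m (T f) \<le> L1_norm m f"
proof -
  have af: "(\<lambda>x. \<bar>f x\<bar>) \<in> L1 m" and zero: "(\<lambda>x. 0) \<in> L1 m" and mf: "(\<lambda>x. 0 - f x) \<in> L1 m"
    using f by (auto simp: L1_def)
  have "AE x in m. T (\<lambda>x. 0 - f x) x = T (\<lambda>x. 0) x - T f x"
    by (rule markov_operator_diff[OF zero f])
  moreover have "AE x in m. T (\<lambda>x. 0) x = 0"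
    using markov_operator_diff[OF zero zero] by simp
  moreover have "AE x in m. T f x \<le> T (\<lambda>x. \<bar>f x\<bar>) x"
    by (rule markov_operator_mono[OF f af]) auto
  moreover have "AE x in m. T (\<lambda>x. 0 - f x) x \<le> T (\<lambda>x. \<bar>f x\<bar>) x"
    by (rule markov_operator_mono[OF mf af]) auto
  ultimately have "AE x in m. \<bar>T f x\<bar> \<le> T (\<lambda>x. \<bar>f x\<bar>) x"
    by eventually_elim auto
  then have "(\<integral>x. \<bar>T f x\<bar> \<partial>m) \<le> (\<integral>x. T (\<lambda>x. \<bar>f x\<bar>) x \<partial>m)"
    using markov_operator_L1[OF f] markov_operator_L1[OF af]
    by (intro integral_mono_AE) (auto simp: L1_def)
  then show ?thesis
    using markov_operator_integral[OF af] by (simp add: L1_norm_def)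
qed

end

lemma markov_operator_id: "markov_operator m id"
  by (auto simp: markov_operator_def)

lemma markov_operator_comp:
  assumes T: "markov_operator m T" and S: "markov_operator m S"
  shows "markov_operator m (T \<circ> S)"
  unfolding markov_operator_def
proof (intro conjI ballI allI impI)
  fix f g a b assume fg: "f \<in> L1 m" "g \<in> L1 m"
  have L: "(\<lambda>y. a * u y + b * v y) \<in> L1 m" if "u \<in> L1 m" "v \<in> L1 m" for u v :: "'a \<Rightarrow> real"
    using that by (auto simp: L1_def)
  note Sfg = markov_operator_L1[OF S fg(1)] markov_operator_L1[OF S fg(2)]
  have "AE x in m. S (\<lambda>y. a * f y + b * g y) x = a * S f x + b * S g x"
    using S fg by (auto simp: markov_operator_def)
  \<comment> \<open>Linearity of \<open>S\<close> holds only a.e., so it cannot be rewritten under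
    \<open>T\<close>.\<close>
  from markov_operator_cong_AE[OF T markov_operator_L1[OF S L[OF fg]] L[OF Sfg] this]
  have "AE x in m. T (S (\<lambda>y. a * f y + b * g y)) x = T (\<lambda>x. a * S f x + b * S g x) x" .
  moreover have "AE x in m. T (\<lambda>x. a * S f x + b * S g x) x = a * T (S f) x + b * T (S g) x"
    using T Sfg by (auto simp: markov_operator_def)
  ultimately show "AE x in m. (T \<circ> S) (\<lambda>y. a * f y + b * g y) x = a * (T \<circ> S) f x + b * (T \<circ> S) g x"
    by eventually_elim simp
qed (use T S in \<open>auto simp: markov_operator_def\<close>)

lemma markov_operator_iterate:
  assumes "\<And>n. markov_operator m (P ((\<sigma> ^^ n) \<omega>))"
  shows "markov_operator m (iterate P \<sigma> n \<omega>)"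
  by (induction n) (simp_all only: iterate.simps markov_operator_id markov_operator_comp assms)


lemma iterate_in_L1:
  assumes "\<And>n. markov_operator m (P ((\<sigma> ^^ n) \<omega>))" "f \<in> L1 m"
  shows "iterate P \<sigma> n \<omega> f \<in> L1 m"
  by (rule markov_operator_L1[OF markov_operator_iterate[of m P \<sigma> \<omega>, OF assms(1)] assms(2)])


subsection \<open>Observables\<close>

lemma AE_abs_le_Linf_norm:
  assumes "g \<in> Linf m"
  shows "AE x in m. \<bar>g x\<bar> \<le> Linf_norm m g"
proof -
  define e where "e = esssup m (\<lambda>x. ereal \<bar>g x\<bar>)"
  obtain C where C: "AE x in m. \<bar>g x\<bar> \<le> C" and g [measurable]: "g \<in> borel_measurable m"
    using assms by (auto simp: Linf_def)
  have "e \<le> ereal C"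
    unfolding e_def using C by (intro esssup_I) auto
  moreover have "AE x in m. ereal \<bar>g x\<bar> \<le> e"
    unfolding e_def by (rule esssup_AE)
  \<comment> \<open>The bound by \<open>C\<close> excludes the value \<infinity>, which
    \<open>real_of_ereal\<close> would turn into 0.\<close>
  ultimately show ?thesis
    unfolding Linf_norm_def e_def[symmetric] by (cases e) auto
qed

lemma integral_mult_Linf_bound:
  assumes f: "f \<in> L1 m" and g: "g \<in> borel_measurable m" "AE x in m. \<bar>g x\<bar> \<le> C"
  shows "integrable m (\<lambda>x. f x * g x)" "\<bar>\<integral>x. f x * g x \<partial>m\<bar> \<le> C * L1_norm m f"
proof -
  have fi: "integrable m f"
    using f by (simp add: L1_def)
  then have Ci: "integrable m (\<lambda>x. C * \<bar>f x\<bar>)"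
    by simp
  have b: "AE x in m. \<bar>f x * g x\<bar> \<le> C * \<bar>f x\<bar>"
    using g(2) by eventually_elim (metis abs_ge_zero abs_mult mult.commute mult_right_mono)
  show i: "integrable m (\<lambda>x. f x * g x)"
  proof (rule Bochner_Integration.integrable_bound[OF Ci])
    show "AE x in m. norm (f x * g x) \<le> norm (C * \<bar>f x\<bar>)"
      using b by eventually_elim simp
  qed (use fi g(1) in measurable)
  have "\<bar>\<integral>x. f x * g x \<partial>m\<bar> \<le> (\<integral>x. \<bar>f x * g x\<bar> \<partial>m)"
    by (rule integral_abs_bound)
  also have "\<dots> \<le> (\<integral>x. C * \<bar>f x\<bar> \<partial>m)"
    using i Ci b by (intro integral_mono_AE) auto
  finally show "\<bar>\<integral>x. f x * g x \<partial>m\<bar> \<le> C * L1_norm m f"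
    by (simp add: L1_norm_def)
qed

section \<open>Countable approximation and separating test functions\<close>

text \<open>Any map out of a countable discrete space is measurable and has countable range, so
  measurability and separability hold however the functions \<open>F c\<close> are chosen.\<close>

lemma countably_valued_bounded_measurable_Linf:
  fixes F :: "'c::countable \<Rightarrow> 'a \<Rightarrow> real"
  assumes m: "prob_space m"
    and k: "k \<in> measurable W (count_space UNIV)"
    and F: "\<And>c. F c \<in> borel_measurable m" "\<And>c x. \<bar>F c x\<bar> \<le> 1"
  shows "(\<lambda>\<omega>. F (k \<omega>)) \<in> bounded_measurable W (Linf m) (Linf_norm m)"
  unfolding bounded_measurable_def
proof (intro CollectI conjI)
  interpret prob_space m by (rule m)
  have FL: "F c \<in> Linf m" for c
    using F by (auto simp: Linf_def intro!: exI[of _ 1])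
  have "F \<in> measurable (count_space UNIV) (seminorm_borel (Linf m) (Linf_norm m))"
    using FL by (simp add: measurable_count_space_eq1)
  from measurable_compose[OF k this]
  show "(\<lambda>\<omega>. F (k \<omega>)) \<in> measurable W (seminorm_borel (Linf m) (Linf_norm m))" .
  have "Linf_norm m (\<lambda>x. 0) = 0"
    unfolding Linf_norm_def by (subst esssup_const) (auto simp: emeasure_space_1)
  then have "Linf_norm m (u - u) = 0" for u :: "'a \<Rightarrow> real"
    by (simp add: fun_diff_def)
  then have "\<exists>q\<in>range F. Linf_norm m (F c - q) < \<epsilon>" if "\<epsilon> > 0" for c \<epsilon>
    using that by (intro bexI[of _ "F c"]) auto
  then show "separable_subset (Linf m) (Linf_norm m) ((\<lambda>\<omega>. F (k \<omega>)) ` space W)"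
    unfolding separable_subset_def using FL
    by (intro exI[of _ "range F"]) auto
  have "Linf_norm m (F c) \<le> 1" for c
  proof -
    have "esssup m (\<lambda>x. ereal \<bar>F c x\<bar>) \<le> 1"
      using F by (intro esssup_I) auto
    then show ?thesis
      unfolding Linf_norm_def by (cases "esssup m (\<lambda>x. ereal \<bar>F c x\<bar>)") auto
  qed
  then show "\<exists>C. \<forall>\<omega>\<in>space W. Linf_norm m (F (k \<omega>)) \<le> C"
    by blast
qed

text \<open>Enumerate a countable set that is dense for the range of \<open>F\<close> and send
  \<omega> to the least index within \<epsilon> of \<open>F \<omega>\<close>. Taking the least index
  makes the choice measurable, since each closeness condition is the preimage of a ball.\<close>

lemma countable_net:
  assumes W: "prob_space W" and E: "E \<subseteq> L1 m"
    and F: "F \<in> bounded_measurable W E (L1_norm m)" and e: "\<epsilon> > 0"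
  obtains q :: "nat \<Rightarrow> 'a \<Rightarrow> real" and k :: "'w \<Rightarrow> nat"
  where "\<And>s. q s \<in> E" "k \<in> measurable W (count_space UNIV)"
    "\<And>\<omega>. \<omega> \<in> space W \<Longrightarrow> L1_norm m (F \<omega> - q (k \<omega>)) < \<epsilon>"
proof -
  interpret prob_space W by (rule W)
  have "separable_subset E (L1_norm m) (F ` space W)"
    using F by (simp add: bounded_measurable_def)
  then obtain Q where Q: "countable Q" "Q \<subseteq> E"
    and dense: "\<forall>u\<in>F ` space W. \<forall>\<delta>>0. \<exists>q\<in>Q. L1_norm m (u - q) < \<delta>"
    unfolding separable_subset_def by (elim exE conjE)
  \<comment> \<open>A probability space has a point, so there is a value of \<open>F\<close> to
    approximate; \<open>from_nat_into\<close> enumerates only nonempty sets.\<close>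
  have ne: "Q \<noteq> {}"
    using dense not_empty e by (metis all_not_in_conv imageI)
  define q where "q = from_nat_into Q"
  have range_q: "range q = Q"
    using ne Q(1) by (simp add: q_def range_from_nat_into)
  then have qE: "q s \<in> E" for s
    using Q(2) by auto
  define k where "k \<omega> = (LEAST s. L1_norm m (F \<omega> - q s) < \<epsilon>)" for \<omega>
  have Fm: "F \<in> measurable W (seminorm_borel E (L1_norm m))"
    using F by (simp add: bounded_measurable_def)
  have "Measurable.pred W (\<lambda>\<omega>. L1_norm m (F \<omega> - q s) < \<epsilon>)" for s
  proof -
    have "F -` {u \<in> E. L1_norm m (u - q s) < \<epsilon>} \<inter> space W \<in> sets W"
      by (rule measurable_sets[OF Fm L1_ball_in_sets[OF E qE]])
    also have "F -` {u \<in> E. L1_norm m (u - q s) < \<epsilon>} \<inter> space W =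
        {\<omega> \<in> space W. L1_norm m (F \<omega> - q s) < \<epsilon>}"
      using bounded_measurable_space[OF F] by auto
    finally show ?thesis by (simp add: pred_def)
  qed
  then have "k \<in> measurable W (count_space UNIV)"
    unfolding k_def by (rule measurable_Least)
  moreover have "L1_norm m (F \<omega> - q (k \<omega>)) < \<epsilon>" if "\<omega> \<in> space W" for \<omega>
  proof -
    have "\<exists>s. L1_norm m (F \<omega> - q s) < \<epsilon>"
      using dense[rule_format, OF imageI[OF that] e] range_q by blast
    then show ?thesis
      unfolding k_def by (rule LeastI_ex)
  qed
  ultimately show thesis
    using qE that by blast
qed

text \<open>If \<open>p\<close> and \<open>q\<close> were equal to \<open>u\<close> and
  \<open>v\<close>, then \<open>h\<close> would select the support of \<open>u\<close>, giving the
  integral 1. Approximation costs at most the two distances.\<close>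

lemma integral_separating_indicator:
  assumes u: "u \<in> densities m" and v: "v \<in> densities m"
    and p: "p \<in> L1 m" and q: "q \<in> L1 m"
    and disj: "support m u \<inter> support m v \<in> null_sets m"
  defines "h \<equiv> \<lambda>x. if q x < p x then 1 else (0::real)"
  shows "1 - L1_norm m (u - p) - L1_norm m (v - q) \<le> (\<integral>x. (u x - v x) * h x \<partial>m)"
proof -
  note u' = densitiesD[OF u] and v' = densitiesD[OF v]
  have pq [simp]: "integrable m p" "integrable m q"
    using p q by (auto simp: L1_def)
  have [measurable]: "p \<in> borel_measurable m" "q \<in> borel_measurable m"
    by (rule borel_measurable_integrable; fact)+
  have "AE x in m. x \<notin> support m u \<inter> support m v"
    by (rule AE_not_in[OF disj])
  then have "AE x in m. u x = 0 \<or> v x = 0"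
    using AE_space by eventually_elim (auto simp: support_def)
  \<comment> \<open>Only a wrong choice by \<open>h\<close> matters. If \<open>v x = 0\<close> but
    \<open>p x \<le> q x\<close>, then \<open>u x\<close> is at most the sum of the two errors; if
    \<open>u x = 0\<close> but \<open>q x < p x\<close>, the same holds for
    \<open>v x\<close>.\<close>
  then have "AE x in m. u x - \<bar>u x - p x\<bar> - \<bar>v x - q x\<bar> \<le> (u x - v x) * h x"
    using u'(2) v'(2) by eventually_elim (auto simp: h_def)
  moreover have "integrable m (\<lambda>x. (u x - v x) * h x)"
    using u' v' by (intro integral_mult_Linf_bound(1)[where C = 1]) (auto simp: L1_def h_def)
  ultimately have "(\<integral>x. u x - \<bar>u x - p x\<bar> - \<bar>v x - q x\<bar> \<partial>m) \<le> (\<integral>x. (u x - v x) * h x \<partial>m)"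
    using u' v' by (intro integral_mono_AE) auto
  moreover have "(\<integral>x. u x - \<bar>u x - p x\<bar> - \<bar>v x - q x\<bar> \<partial>m) =
      1 - (\<integral>x. \<bar>u x - p x\<bar> \<partial>m) - (\<integral>x. \<bar>v x - q x\<bar> \<partial>m)"
    using u' v' by simp
  ultimately show ?thesis
    by (simp add: L1_norm_def)
qed


subsection \<open>Asymptotic periodicity and mixing\<close>

text \<open>The permutations met along the orbit compose. The resulting permutation depends on both
  \<omega> and \<open>n\<close>.\<close>

lemma iterate_periodic:
  assumes markov: "\<And>n. markov_operator m (P ((\<sigma> ^^ n) \<omega>))"
    and phi: "\<And>i n. i \<in> I \<Longrightarrow> \<phi> i ((\<sigma> ^^ n) \<omega>) \<in> L1 m"
    and perm: "\<And>n. \<exists>\<rho>. \<rho> permutes I \<and>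
      (\<forall>i\<in>I. AE x in m. P ((\<sigma> ^^ n) \<omega>) (\<phi> i ((\<sigma> ^^ n) \<omega>)) x = \<phi> (\<rho> i) (\<sigma> ((\<sigma> ^^ n) \<omega>)) x)"
  shows "\<exists>\<pi>. \<pi> permutes I \<and>
    (\<forall>i\<in>I. AE x in m. iterate P \<sigma> n \<omega> (\<phi> i \<omega>) x = \<phi> (\<pi> i) ((\<sigma> ^^ n) \<omega>) x)"
proof (induction n)
  case 0
  show ?case by (intro exI[of _ id] conjI permutes_id) simp
next
  case (Suc n)
  then obtain \<pi> where \<pi>: "\<pi> permutes I"
    "\<And>i. i \<in> I \<Longrightarrow> AE x in m. iterate P \<sigma> n \<omega> (\<phi> i \<omega>) x = \<phi> (\<pi> i) ((\<sigma> ^^ n) \<omega>) x"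
    by blast
  obtain \<rho> where \<rho>: "\<rho> permutes I"
    "\<And>i. i \<in> I \<Longrightarrow>
      AE x in m. P ((\<sigma> ^^ n) \<omega>) (\<phi> i ((\<sigma> ^^ n) \<omega>)) x = \<phi> (\<rho> i) (\<sigma> ((\<sigma> ^^ n) \<omega>)) x"
    using perm[of n] by blast
  have "AE x in m. iterate P \<sigma> (Suc n) \<omega> (\<phi> i \<omega>) x = \<phi> ((\<rho> \<circ> \<pi>) i) ((\<sigma> ^^ Suc n) \<omega>) x"
    if i: "i \<in> I" for i
  proof -
    have \<pi>i: "\<pi> i \<in> I"
      using \<pi>(1) i by (simp add: permutes_in_image)
    have "\<phi> i \<omega> \<in> L1 m"
      using phi[OF i, of 0] by simp
    then have "iterate P \<sigma> n \<omega> (\<phi> i \<omega>) \<in> L1 m"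
      by (rule iterate_in_L1[of m P \<sigma> \<omega>, OF markov])
    from markov_operator_cong_AE[OF markov[of n] this phi[OF \<pi>i] \<pi>(2)[OF i]] \<rho>(2)[OF \<pi>i]
    show ?thesis by eventually_elim simp
  qed
  then show ?case
    using permutes_compose[OF \<pi>(1) \<rho>(1)] by blast
qed

section \<open>Implications between exactness, mixing and stability\<close>

text \<open>The observables have one common bound along the orbit, so the pairing is dominated by a
  constant times the norm of the iterate.\<close>

lemma exact_imp_prior_mixing:
  assumes \<sigma>: "measure_preserving_map W \<sigma>" and P: "markov_cocycle m W P"
    and exact: "exact_cocycle m W \<sigma> P"
  shows "prior_mixing m W \<sigma> P"
proof -
  have "AE \<omega> in W. \<forall>n. markov_operator m (P ((\<sigma> ^^ n) \<omega>))"
    using P by (intro AE_measure_preserving_funpow[OF \<sigma>]) (simp add: markov_cocycle_def)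
  with exact[unfolded exact_cocycle_def] AE_space show ?thesis
    unfolding prior_mixing_def
  proof eventually_elim
    case (elim \<omega>)
    show ?case
    proof (intro ballI)
      fix f g assume f: "f \<in> L1_zero m" and g: "g \<in> bounded_measurable W (Linf m) (Linf_norm m)"
      obtain C where C: "\<And>\<omega>. \<omega> \<in> space W \<Longrightarrow> Linf_norm m (g \<omega>) \<le> C"
        using g by (auto simp: bounded_measurable_def)
      have "\<bar>\<integral>x. iterate P \<sigma> n \<omega> f x * g ((\<sigma> ^^ n) \<omega>) x \<partial>m\<bar>
          \<le> C * L1_norm m (iterate P \<sigma> n \<omega> f)" for n
      proof (rule integral_mult_Linf_bound(2))
        have n: "(\<sigma> ^^ n) \<omega> \<in> space W"
          by (rule funpow_measure_preserving_in_space[OF \<sigma> elim(2)])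
        have gn: "g ((\<sigma> ^^ n) \<omega>) \<in> Linf m"
          by (rule bounded_measurable_space[OF g n])
        then show "g ((\<sigma> ^^ n) \<omega>) \<in> borel_measurable m"
          by (simp add: Linf_def)
        show "AE x in m. \<bar>g ((\<sigma> ^^ n) \<omega>) x\<bar> \<le> C"
          using AE_abs_le_Linf_norm[OF gn] by eventually_elim (use C[OF n] in simp)
        show "iterate P \<sigma> n \<omega> f \<in> L1 m"
          using f elim(3) by (intro iterate_in_L1) (simp_all add: L1_zero_def)
      qed
      then have "\<forall>\<^sub>F n in sequentially.
          norm (\<integral>x. iterate P \<sigma> n \<omega> f x * g ((\<sigma> ^^ n) \<omega>) x \<partial>m) \<le> C * L1_norm m (iterate P \<sigma> n \<omega> f)"
        by (intro always_eventually allI) (simp only: real_norm_def)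
      moreover have "(\<lambda>n. C * L1_norm m (iterate P \<sigma> n \<omega> f)) \<longlonglongrightarrow> 0"
        using elim(1) f by (intro tendsto_mult_right_zero) blast
      ultimately show "(\<lambda>n. \<integral>x. iterate P \<sigma> n \<omega> f x * g ((\<sigma> ^^ n) \<omega>) x \<partial>m) \<longlonglongrightarrow> 0"
        by (rule Lim_null_comparison)
    qed
  qed
qed

text \<open>A single null set that serves all pairs serves each pair.\<close>

lemma prior_imp_posterior_mixing:
  assumes "prior_mixing m W \<sigma> P"
  shows "posterior_mixing m W \<sigma> P"
  unfolding posterior_mixing_def
proof (intro ballI)
  fix f g assume fg: "f \<in> L1_zero m" "g \<in> bounded_measurable W (Linf m) (Linf_norm m)"
  from assms[unfolded prior_mixing_def]
  show "AE \<omega> in W. (\<lambda>n. \<integral>x. iterate P \<sigma> n \<omega> f x * g ((\<sigma> ^^ n) \<omega>) x \<partial>m) \<longlonglongrightarrow> 0"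
    by eventually_elim (use fg in blast)
qed

text \<open>Separates the permutation structure, from which the period is bounded, from the
  convergence that yields exactness.\<close>

lemma asymptotically_periodic_withE:
  assumes "asymptotically_periodic_with r m W \<sigma> P"
  obtains lam \<phi>
  where "\<And>i. i \<in> {1..r} \<Longrightarrow> \<phi> i \<in> bounded_measurable W (densities m) (L1_norm m)"
    and "AE \<omega> in W.
      (\<forall>i\<in>{1..r}. \<forall>j\<in>{1..r}. i \<noteq> j \<longrightarrow>
        support m (\<phi> i \<omega>) \<inter> support m (\<phi> j \<omega>) \<in> null_sets m) \<and>
      (\<exists>\<rho>. \<rho> permutes {1..r} \<and>
        (\<forall>i\<in>{1..r}. AE x in m. P \<omega> (\<phi> i \<omega>) x = \<phi> (\<rho> i) (\<sigma> \<omega>) x))"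
    and "AE \<omega> in W. \<forall>f\<in>L1 m.
      (\<lambda>n. L1_norm m (iterate P \<sigma> n \<omega>
        (\<lambda>x. f x - (\<Sum>i\<in>{1..r}. lam i \<omega> f * \<phi> i \<omega> x)))) \<longlonglongrightarrow> 0"
proof -
  obtain lam \<phi>
    where \<phi>: "\<forall>i\<in>{1..r}. \<phi> i \<in> bounded_measurable W (densities m) (L1_norm m)"
    and ae: "AE \<omega> in W.
      (\<forall>i\<in>{1..r}. \<forall>j\<in>{1..r}. i \<noteq> j \<longrightarrow>
        support m (\<phi> i \<omega>) \<inter> support m (\<phi> j \<omega>) \<in> null_sets m) \<and>
      (\<exists>\<rho>. \<rho> permutes {1..r} \<and>
        (\<forall>i\<in>{1..r}. AE x in m. P \<omega> (\<phi> i \<omega>) x = \<phi> (\<rho> i) (\<sigma> \<omega>) x) \<and>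
        (\<forall>f\<in>L1 m. (\<lambda>n. L1_norm m (iterate P \<sigma> n \<omega>
          (\<lambda>x. f x - (\<Sum>i\<in>{1..r}. lam i \<omega> f * \<phi> i \<omega> x)))) \<longlonglongrightarrow> 0))"
    using assms unfolding asymptotically_periodic_with_def by (elim exE conjE)
  show thesis
  proof (rule that)
    show "\<phi> i \<in> bounded_measurable W (densities m) (L1_norm m)" if "i \<in> {1..r}" for i
      using \<phi> that by (rule bspec)
  next
    show "AE \<omega> in W.
      (\<forall>i\<in>{1..r}. \<forall>j\<in>{1..r}. i \<noteq> j \<longrightarrow>
        support m (\<phi> i \<omega>) \<inter> support m (\<phi> j \<omega>) \<in> null_sets m) \<and>
      (\<exists>\<rho>. \<rho> permutes {1..r} \<and>
        (\<forall>i\<in>{1..r}. AE x in m. P \<omega> (\<phi> i \<omega>) x = \<phi> (\<rho> i) (\<sigma> \<omega>) x))"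
      using ae
    proof eventually_elim
      case (elim \<omega>)
      from elim[THEN conjunct2] obtain \<rho> where "\<rho> permutes {1..r}"
        "\<forall>i\<in>{1..r}. AE x in m. P \<omega> (\<phi> i \<omega>) x = \<phi> (\<rho> i) (\<sigma> \<omega>) x"
        by (elim exE conjE)
      with elim[THEN conjunct1] show ?case by (intro conjI exI[of _ \<rho>])
    qed
    show "AE \<omega> in W. \<forall>f\<in>L1 m.
      (\<lambda>n. L1_norm m (iterate P \<sigma> n \<omega>
        (\<lambda>x. f x - (\<Sum>i\<in>{1..r}. lam i \<omega> f * \<phi> i \<omega> x)))) \<longlonglongrightarrow> 0"
      using ae
    proof eventually_elim
      case (elim \<omega>)
      then show ?case by (elim conjE exE)
    qed
  qed
qed

text \<open>Integrals are preserved, so the coefficient of a mean-zero \<open>f\<close> bounds the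
  norms of all iterates of the remainder \<open>h\<close> from below. These tend to 0, hence the
  coefficient vanishes and \<open>h\<close> is \<open>f\<close> itself.\<close>

lemma asymptotically_stable_imp_exact:
  assumes \<sigma>: "measure_preserving_map W \<sigma>" and P: "markov_cocycle m W P"
    and stable: "asymptotically_stable m W \<sigma> P"
  shows "exact_cocycle m W \<sigma> P"
proof -
  obtain lam \<phi> where \<phi>: "\<phi> (1::nat) \<in> bounded_measurable W (densities m) (L1_norm m)"
    and conv: "AE \<omega> in W. \<forall>f\<in>L1 m.
      (\<lambda>n. L1_norm m (iterate P \<sigma> n \<omega>
        (\<lambda>x. f x - (\<Sum>i\<in>{1..1}. lam i \<omega> f * \<phi> i \<omega> x)))) \<longlonglongrightarrow> 0"
    using stable unfolding asymptotically_stable_def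
    by (rule asymptotically_periodic_withE) simp
  have "AE \<omega> in W. \<forall>n. markov_operator m (P ((\<sigma> ^^ n) \<omega>))"
    using P by (intro AE_measure_preserving_funpow[OF \<sigma>]) (simp add: markov_cocycle_def)
  with conv AE_space show ?thesis
    unfolding exact_cocycle_def
  proof eventually_elim
    case (elim \<omega>)
    show ?case
    proof
      fix f assume f: "f \<in> L1_zero m"
      then have fL: "integrable m f" and f0: "(\<integral>x. f x \<partial>m) = 0"
        by (auto simp: L1_zero_def L1_def)
      note \<phi>' = densitiesD[OF bounded_measurable_space[OF \<phi> elim(2)]]
      define h where "h = (\<lambda>x. f x - lam 1 \<omega> f * \<phi> 1 \<omega> x)"
      have h: "h \<in> L1 m"
        using fL \<phi>' by (auto simp: h_def L1_def)
      have lim: "(\<lambda>n. L1_norm m (iterate P \<sigma> n \<omega> h)) \<longlonglongrightarrow> 0"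
        using elim(1) fL by (auto simp: h_def L1_def)
      have h_int: "(\<integral>x. h x \<partial>m) = - lam 1 \<omega> f"
        using fL \<phi>' f0 by (simp add: h_def)
      have "\<bar>lam 1 \<omega> f\<bar> \<le> L1_norm m (iterate P \<sigma> n \<omega> h)" for n
      proof -
        have "(\<integral>x. iterate P \<sigma> n \<omega> h x \<partial>m) = - lam 1 \<omega> f"
          using elim(3) h_int by (subst markov_operator_integral[OF markov_operator_iterate h]) auto
        then show ?thesis
          using integral_abs_bound[of m "iterate P \<sigma> n \<omega> h"] by (simp add: L1_norm_def)
      qed
      then have "\<bar>lam 1 \<omega> f\<bar> \<le> 0"
        by (intro LIMSEQ_le_const[OF lim]) auto
      then have "h = f"
        by (simp add: h_def)
      with lim show "(\<lambda>n. L1_norm m (iterate P \<sigma> n \<omega> f)) \<longlonglongrightarrow> 0"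
        by simp
    qed
  qed
qed

text \<open>
  The indicator of the support of \<open>\<phi> \<omega>\<close> would do for each single \<open>\<omega>\<close>, but as a function of \<open>\<omega>\<close> it is in general not
  separably valued in \<open>L\<^sup>\<infinity>\<close>; hence the countably valued approximation.
\<close>
lemma separating_observable:
  assumes m: "prob_space m" and W: "prob_space W"
    and a: "\<phi> \<in> bounded_measurable W (densities m) (L1_norm m)"
    and b: "\<psi> \<in> bounded_measurable W (densities m) (L1_norm m)"
    and e: "\<epsilon> > 0"
  obtains g where "g \<in> bounded_measurable W (Linf m) (Linf_norm m)"
    "\<And>\<omega>. g \<omega> \<in> borel_measurable m" "\<And>\<omega> x. \<bar>g \<omega> x\<bar> \<le> 1"
    "\<And>\<omega>. \<omega> \<in> space W \<Longrightarrow> support m (\<phi> \<omega>) \<inter> support m (\<psi> \<omega>) \<in> null_sets m \<Longrightarrow>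
      1 - 2 * \<epsilon> \<le> (\<integral>x. (\<phi> \<omega> x - \<psi> \<omega> x) * g \<omega> x \<partial>m)"
proof -
  have D: "densities m \<subseteq> L1 m"
    by (auto simp: densities_def)
  obtain p :: "nat \<Rightarrow> 'a \<Rightarrow> real" and k where p: "\<And>s. p s \<in> densities m" and k [measurable]: "k \<in> measurable W (count_space UNIV)"
    and pk: "\<And>\<omega>. \<omega> \<in> space W \<Longrightarrow> L1_norm m (\<phi> \<omega> - p (k \<omega>)) < \<epsilon>"
    using countable_net[OF W D a e] by blast
  obtain q :: "nat \<Rightarrow> 'a \<Rightarrow> real" and l where q: "\<And>s. q s \<in> densities m" and l [measurable]: "l \<in> measurable W (count_space UNIV)"
    and ql: "\<And>\<omega>. \<omega> \<in> space W \<Longrightarrow> L1_norm m (\<psi> \<omega> - q (l \<omega>)) < \<epsilon>"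
    using countable_net[OF W D b e] by blast
  define F where "F = (\<lambda>(s, t) x. if q t x < p s x then 1 else (0::real))"
  have [measurable]: "p s \<in> borel_measurable m" "q s \<in> borel_measurable m" for s
    using densitiesD(1)[OF p] densitiesD(1)[OF q] by (auto intro: borel_measurable_integrable)
  have F: "F c \<in> borel_measurable m" "\<bar>F c x\<bar> \<le> 1" for c x
    by (auto simp: F_def split: prod.split)
  have kl: "(\<lambda>\<omega>. (k \<omega>, l \<omega>)) \<in> measurable W (count_space UNIV)"
    by measurable
  show thesis
  proof (rule that)
    show "(\<lambda>\<omega>. F (k \<omega>, l \<omega>)) \<in> bounded_measurable W (Linf m) (Linf_norm m)"
      by (rule countably_valued_bounded_measurable_Linf[OF m kl F])
    fix \<omega> assume \<omega>: "\<omega> \<in> space W"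
      and disj: "support m (\<phi> \<omega>) \<inter> support m (\<psi> \<omega>) \<in> null_sets m"
    have "1 - L1_norm m (\<phi> \<omega> - p (k \<omega>)) - L1_norm m (\<psi> \<omega> - q (l \<omega>))
        \<le> (\<integral>x. (\<phi> \<omega> x - \<psi> \<omega> x) * F (k \<omega>, l \<omega>) x \<partial>m)"
      unfolding F_def split using p q D
      by (intro integral_separating_indicator bounded_measurable_space[OF a \<omega>]
          bounded_measurable_space[OF b \<omega>] disj) auto
    with pk[OF \<omega>] ql[OF \<omega>]
    show "1 - 2 * \<epsilon> \<le> (\<integral>x. (\<phi> \<omega> x - \<psi> \<omega> x) * F (k \<omega>, l \<omega>) x \<partial>m)"
      by simp
  qed (rule F)+
qed

lemma posterior_mixing_imp_period_one:
  assumes m: "prob_space m" and W: "prob_space W"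
    and \<sigma>: "measure_preserving_map W \<sigma>" and P: "markov_cocycle m W P"
    and per: "asymptotically_periodic_with r m W \<sigma> P"
    and mixing: "posterior_mixing m W \<sigma> P"
  shows "r \<le> 1"
proof (rule ccontr)
  assume "\<not> r \<le> 1"
  then have one: "1 \<in> {1..r}" and two: "2 \<in> {1..r}"
    by auto
  interpret W: prob_space W by (rule W)
  from per obtain \<phi>
    where \<phi>: "\<And>i. i \<in> {1..r} \<Longrightarrow> \<phi> i \<in> bounded_measurable W (densities m) (L1_norm m)"
    and "AE \<omega> in W.
           (\<forall>i\<in>{1..r}. \<forall>j\<in>{1..r}. i \<noteq> j \<longrightarrow>
              support m (\<phi> i \<omega>) \<inter> support m (\<phi> j \<omega>) \<in> null_sets m) \<and>
           (\<exists>\<rho>. \<rho> permutes {1..r} \<and>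
              (\<forall>i\<in>{1..r}. AE x in m. P \<omega> (\<phi> i \<omega>) x = \<phi> (\<rho> i) (\<sigma> \<omega>) x))"
    (is "AE \<omega> in W. ?Q \<omega>")
    by (rule asymptotically_periodic_withE) (rule that, blast, assumption)
  then have Q: "AE \<omega> in W. \<forall>n. ?Q ((\<sigma> ^^ n) \<omega>)"
    by (intro AE_measure_preserving_funpow[OF \<sigma>])
  have markov: "AE \<omega> in W. \<forall>n. markov_operator m (P ((\<sigma> ^^ n) \<omega>))"
    using P by (intro AE_measure_preserving_funpow[OF \<sigma>]) (simp add: markov_cocycle_def)
  have D: "densities m \<subseteq> L1 m"
    by (auto simp: densities_def)
  \<comment> \<open>With 1/8 the separation is at least 3/4 and replacing both densities costs less
    than 1/4, so pairings below 1/2 give a contradiction.\<close>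
  have eps: "(1/8::real) > 0" by simp
  obtain p :: "nat \<Rightarrow> 'a \<Rightarrow> real" and k where p: "\<And>s. p s \<in> densities m" "k \<in> measurable W (count_space UNIV)"
    and pk: "\<And>\<omega>. \<omega> \<in> space W \<Longrightarrow> L1_norm m (\<phi> 1 \<omega> - p (k \<omega>)) < 1/8"
    using countable_net[OF W D \<phi>[OF one] eps] by blast
  obtain q :: "nat \<Rightarrow> 'a \<Rightarrow> real" and l where q: "\<And>s. q s \<in> densities m" "l \<in> measurable W (count_space UNIV)"
    and ql: "\<And>\<omega>. \<omega> \<in> space W \<Longrightarrow> L1_norm m (\<phi> 2 \<omega> - q (l \<omega>)) < 1/8"
    using countable_net[OF W D \<phi>[OF two] eps] by blast
  \<comment> \<open>Which pair of densities is met at time \<open>n\<close> depends on \<omega> and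
    \<open>n\<close>, so an observable is fixed in advance for every pair. The diagonal is harmless:
    separation is claimed only for null intersections.\<close>
  define good where "good i j h \<longleftrightarrow>
      h \<in> bounded_measurable W (Linf m) (Linf_norm m) \<and>
      (\<forall>\<omega>. h \<omega> \<in> borel_measurable m) \<and> (\<forall>\<omega> x. \<bar>h \<omega> x\<bar> \<le> 1) \<and>
      (\<forall>\<omega>\<in>space W. support m (\<phi> i \<omega>) \<inter> support m (\<phi> j \<omega>) \<in> null_sets m \<longrightarrow>
        1 - 2 * (1/8) \<le> (\<integral>x. (\<phi> i \<omega> x - \<phi> j \<omega> x) * h \<omega> x \<partial>m))" for i j h
  define g where "g i j = (SOME h. good i j h)" for i j
  have "good i j (g i j)" if "i \<in> {1..r}" "j \<in> {1..r}" for i j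
  proof -
    have "\<exists>h. good i j h"
      unfolding good_def
      by (rule separating_observable[OF m W \<phi>[OF that(1)] \<phi>[OF that(2)] eps]) blast
    then show ?thesis
      unfolding g_def by (rule someI_ex)
  qed
  then have g: "\<And>i j. i \<in> {1..r} \<Longrightarrow> j \<in> {1..r} \<Longrightarrow>
        g i j \<in> bounded_measurable W (Linf m) (Linf_norm m)"
    and gm: "\<And>i j \<omega>. i \<in> {1..r} \<Longrightarrow> j \<in> {1..r} \<Longrightarrow> g i j \<omega> \<in> borel_measurable m"
    and g1: "\<And>i j \<omega> x. i \<in> {1..r} \<Longrightarrow> j \<in> {1..r} \<Longrightarrow> \<bar>g i j \<omega> x\<bar> \<le> 1"
    and sep: "\<And>i j \<omega>. i \<in> {1..r} \<Longrightarrow> j \<in> {1..r} \<Longrightarrow> \<omega> \<in> space W \<Longrightarrow>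
        support m (\<phi> i \<omega>) \<inter> support m (\<phi> j \<omega>) \<in> null_sets m \<Longrightarrow>
        1 - 2 * (1/8) \<le> (\<integral>x. (\<phi> i \<omega> x - \<phi> j \<omega> x) * g i j \<omega> x \<partial>m)"
    unfolding good_def by simp_all
  \<comment> \<open>Approximating within the densities keeps the mean of the difference exactly
    zero.\<close>
  have f_zero: "(\<lambda>x. p s x - q t x) \<in> L1_zero m" for s t
    using densitiesD[OF p(1)] densitiesD[OF q(1)] by (auto simp: L1_zero_def L1_def)
  define J where "J s t i j n \<omega> =
      (\<integral>x. iterate P \<sigma> n \<omega> (\<lambda>x. p s x - q t x) x * g i j ((\<sigma> ^^ n) \<omega>) x \<partial>m)" for s t i j n \<omega>
  \<comment> \<open>Mixing gives one null set for each test function and observable; there are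
    finitely many \<open>i\<close>, \<open>j\<close> and countably many \<open>s\<close>,
    \<open>t\<close>.\<close>
  have "AE \<omega> in W. \<forall>i\<in>{1..r}. \<forall>j\<in>{1..r}. (\<lambda>n. J s t i j n \<omega>) \<longlonglongrightarrow> 0" for s t
    using mixing f_zero g by (intro AE_finite_allI) (auto simp: posterior_mixing_def J_def)
  then have "AE \<omega> in W. \<forall>s t. \<forall>i\<in>{1..r}. \<forall>j\<in>{1..r}. (\<lambda>n. J s t i j n \<omega>) \<longlonglongrightarrow> 0"
    by (simp add: AE_all_countable)
  with Q markov AE_space
  have "AE \<omega> in W. False"
  proof eventually_elim
    case (elim \<omega>)
    \<comment> \<open>Once \<omega> is fixed, its own approximant may be picked, since convergence
      already holds for all indices.\<close>
    define f where "f = (\<lambda>x. p (k \<omega>) x - q (l \<omega>) x)"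
    have space_n: "(\<sigma> ^^ n) \<omega> \<in> space W" for n
      by (rule funpow_measure_preserving_in_space[OF \<sigma> elim(3)])
    have \<phi>L: "\<phi> i ((\<sigma> ^^ n) \<omega>) \<in> L1 m" if "i \<in> {1..r}" for i n
      using bounded_measurable_space[OF \<phi>[OF that] space_n] D by blast
    have "\<forall>\<^sub>F n in sequentially. \<bar>J (k \<omega>) (l \<omega>) i j n \<omega>\<bar> < 1/2"
      if "i \<in> {1..r}" "j \<in> {1..r}" for i j
      using tendstoD[OF elim(4)[rule_format, OF that], of "1/2"] by simp
    \<comment> \<open>One time must work for all pairs, because \<open>n\<close> is fixed before the
      permutation \<pi> is known.\<close>
    then have "\<forall>\<^sub>F n in sequentially. \<forall>i\<in>{1..r}. \<forall>j\<in>{1..r}. \<bar>J (k \<omega>) (l \<omega>) i j n \<omega>\<bar> < 1/2"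
      by (intro eventually_ball_finite ballI) auto
    then have "\<exists>n. \<forall>i\<in>{1..r}. \<forall>j\<in>{1..r}. \<bar>J (k \<omega>) (l \<omega>) i j n \<omega>\<bar> < 1/2"
      by (rule eventually_happens'[OF sequentially_bot])
    then obtain n where n: "\<forall>i\<in>{1..r}. \<forall>j\<in>{1..r}. \<bar>J (k \<omega>) (l \<omega>) i j n \<omega>\<bar> < 1/2" ..
    have T: "markov_operator m (iterate P \<sigma> n \<omega>)" (is "markov_operator m ?T")
      by (rule markov_operator_iterate) (rule elim(2)[rule_format])
    have "\<exists>\<pi>. \<pi> permutes {1..r} \<and>
        (\<forall>i\<in>{1..r}. AE x in m. ?T (\<phi> i \<omega>) x = \<phi> (\<pi> i) ((\<sigma> ^^ n) \<omega>) x)"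
    proof (rule iterate_periodic)
      show "markov_operator m (P ((\<sigma> ^^ n) \<omega>))" for n
        using elim(2) by (rule spec)
      show "\<exists>\<rho>. \<rho> permutes {1..r} \<and> (\<forall>i\<in>{1..r}. AE x in m.
          P ((\<sigma> ^^ n) \<omega>) (\<phi> i ((\<sigma> ^^ n) \<omega>)) x = \<phi> (\<rho> i) (\<sigma> ((\<sigma> ^^ n) \<omega>)) x)" for n
        using elim(1)[rule_format, of n] by (rule conjunct2)
    qed (rule \<phi>L)
    then obtain \<pi> where \<pi>: "\<pi> permutes {1..r}"
      and T\<phi>: "\<And>i. i \<in> {1..r} \<Longrightarrow> AE x in m. ?T (\<phi> i \<omega>) x = \<phi> (\<pi> i) ((\<sigma> ^^ n) \<omega>) x"
      by blast
    define a b where "a = \<pi> 1" and "b = \<pi> 2"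
    have ab: "a \<in> {1..r}" "b \<in> {1..r}" "a \<noteq> b"
      using \<pi> one two permutes_inj[OF \<pi>] by (auto simp: a_def b_def permutes_in_image inj_eq
        simp del: atLeastAtMost_iff)
    define u where "u = (\<lambda>x. \<phi> a ((\<sigma> ^^ n) \<omega>) x - \<phi> b ((\<sigma> ^^ n) \<omega>) x)"
    define G where "G = g a b ((\<sigma> ^^ n) \<omega>)"
    have uL: "u \<in> L1 m"
      using \<phi>L[OF ab(1)] \<phi>L[OF ab(2)] by (auto simp: u_def L1_def)
    have fL: "f \<in> L1 m"
      using f_zero by (auto simp: f_def L1_zero_def)
    have \<phi>12: "\<phi> 1 \<omega> \<in> L1 m" "\<phi> 2 \<omega> \<in> L1 m"
      using \<phi>L[OF one, of 0] \<phi>L[OF two, of 0] by simp_all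
    define d where "d = (\<lambda>x. \<phi> 1 \<omega> x - \<phi> 2 \<omega> x)"
    have dL: "d \<in> L1 m"
      using \<phi>12 by (auto simp: d_def L1_def)
    have "AE x in m. u x = ?T d x"
      using T\<phi>[OF one] T\<phi>[OF two] markov_operator_diff[OF T \<phi>12]
      unfolding d_def u_def a_def b_def by eventually_elim simp
    then have diff: "AE x in m. u x - ?T f x = ?T (\<lambda>x. d x - f x) x"
      using markov_operator_diff[OF T dL fL] by eventually_elim simp
    have TfL: "?T f \<in> L1 m"
      by (rule markov_operator_L1[OF T fL])
    have pqL: "p s \<in> L1 m" "q s \<in> L1 m" for s
      using p(1) q(1) D by auto
    have dfL: "(\<lambda>x. d x - f x) \<in> L1 m"
      using dL fL by (auto simp: L1_def)
    \<comment> \<open>Since \<open>u\<close> is a.e. the iterate of \<open>d\<close>, contraction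
      carries the error made at time 0 to time \<open>n\<close> without loss.\<close>
    have "L1_norm m (\<lambda>x. u x - ?T f x) = L1_norm m (?T (\<lambda>x. d x - f x))"
      unfolding L1_norm_def using diff uL TfL markov_operator_L1[OF T dfL]
      by (intro integral_cong_AE) (auto simp: L1_def)
    also have "\<dots> \<le> L1_norm m (\<lambda>x. d x - f x)"
      by (rule markov_operator_contraction[OF T dfL])
    also have "\<dots> = L1_norm m (\<lambda>x. (\<phi> 1 \<omega> x - p (k \<omega>) x) + (q (l \<omega>) x - \<phi> 2 \<omega> x))"
      by (simp add: d_def f_def algebra_simps)
    also have "\<dots> \<le> L1_norm m (\<lambda>x. \<phi> 1 \<omega> x - p (k \<omega>) x) + L1_norm m (\<lambda>x. q (l \<omega>) x - \<phi> 2 \<omega> x)"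
      using \<phi>12 pqL by (intro L1_norm_triangle) (auto simp: L1_def)
    also have "\<dots> < 1/8 + 1/8"
      using pk[OF elim(3)] ql[OF elim(3)]
      by (intro add_strict_mono) (simp_all add: L1_norm_def abs_minus_commute)
    finally have close: "L1_norm m (\<lambda>x. u x - ?T f x) < 1/4" by simp
    have GM: "G \<in> borel_measurable m" "AE x in m. \<bar>G x\<bar> \<le> 1"
      using gm[OF ab(1,2)] g1[OF ab(1,2)] by (auto simp: G_def)
    have "(\<lambda>x. u x - ?T f x) \<in> L1 m"
      using uL TfL by (auto simp: L1_def)
    from integral_mult_Linf_bound(2)[OF this GM]
    have "\<bar>\<integral>x. (u x - ?T f x) * G x \<partial>m\<bar> < 1/4"
      using close by simp
    moreover have "(\<integral>x. (u x - ?T f x) * G x \<partial>m) = (\<integral>x. u x * G x \<partial>m) - (\<integral>x. ?T f x * G x \<partial>m)"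
      using integral_mult_Linf_bound(1)[OF uL GM] integral_mult_Linf_bound(1)[OF TfL GM]
      by (simp add: left_diff_distrib)
    moreover have "1 - 2 * (1/8) \<le> (\<integral>x. u x * G x \<partial>m)"
      unfolding u_def G_def using elim(1)[rule_format, of n] ab by (intro sep[OF ab(1,2) space_n]) simp
    moreover have "\<bar>\<integral>x. ?T f x * G x \<partial>m\<bar> < 1/2"
      using n[rule_format, OF ab(1,2)] by (simp add: J_def f_def G_def)
    ultimately show ?case by linarith
  qed
  \<comment> \<open>A probability space is not null, so a contradiction at almost every point
    suffices.\<close>
  then show False by simp
qed

theorem theorem4p2:
  fixes m :: "'a measure" and W :: "'w measure"
    and \<sigma> :: "'w \<Rightarrow> 'w" and P :: "'w \<Rightarrow> ('a \<Rightarrow> real) \<Rightarrow> ('a \<Rightarrow> real)"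
  assumes "prob_space m" and "prob_space W"
    and "measure_preserving_map W \<sigma>"
    and "markov_cocycle m W P"
    and "asymptotically_periodic m W \<sigma> P"
  shows "(exact_cocycle m W \<sigma> P \<longleftrightarrow> prior_mixing m W \<sigma> P) \<and>
         (prior_mixing m W \<sigma> P \<longleftrightarrow> posterior_mixing m W \<sigma> P) \<and>
         (posterior_mixing m W \<sigma> P \<longleftrightarrow> asymptotically_stable m W \<sigma> P)"
proof -
  obtain r where r: "r \<ge> 1" "asymptotically_periodic_with r m W \<sigma> P"
    using assms(5) by (auto simp: asymptotically_periodic_def)
  \<comment> \<open>This closes the cycle from exactness through prior and posterior mixing to
    stability and back.\<close>
  have "posterior_mixing m W \<sigma> P \<Longrightarrow> asymptotically_stable m W \<sigma> P"
    using posterior_mixing_imp_period_one[OF assms(1-4) r(2)] r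
    by (simp add: asymptotically_stable_def le_antisym)
  moreover note exact_imp_prior_mixing[OF assms(3,4)]
    prior_imp_posterior_mixing[of m W \<sigma> P] asymptotically_stable_imp_exact[OF assms(3,4)]
  ultimately show ?thesis
    by blast
qed

end
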